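(* Let $M$ be an ordered $\Gamma$-semigroup. Then $M$ is left regular and left duo if and only if, for every $x\in M$, $$N(x)=\{y\in M \mid x\in (M\Gamma y]\}.$$
   Context: A $\Gamma$-semigroup consists of nonempty sets $M$ and $\Gamma$ and a well-defined operation $M\times\Gamma\times M\to M$, $(a,\gamma,b)\mapsto a\gamma b$, with $a\gamma(b\mu c)=(a\gamma b)\mu c$ for all $a,b,c\in M$, $\gamma,\mu\in\Gamma$. An ordered $\Gamma$-semigroup ($po$-$\Gamma$-semigroup) is a $\Gamma$-semigroup $M$ with a partial order $\le$ on $M$ such that $a\le b$ implies $a\gamma c\le b\gamma c$ and $c\gamma a\le c\gamma b$ for all $c\in M$, $\gamma\in\Gamma$. Notation: for $A,B\subseteq M$, $A\Gamma B=\{a\gamma b\mid a\in A,\ b\in B,\ \gamma\in\Gamma\}$; singletons are written without braces. Thus $M\Gamma y=\{u\mu y\mid u\in M,\ \mu\in\Gamma\}$ and, for fixed $\gamma\in\Gamma$, $M\Gamma x\gamma x=\{u\mu (x\gamma x)\mid u\in M,\ \mu\in\Gamma\}$. For $H\subseteq M$, $(H]=\{t\in M\mid t\le h\text{ for some }h\in H\}$. $M$ is left regular if $x\in (M\Gamma x\gamma x]$ for every $x\in M$ and every $\gamma\in\Gamma$. A left (resp. right) ideal of $M$ is a nonempty subset $A\subseteq M$ such that (1) $M\Gamma A\subseteq A$ (resp. $A\Gamma M\subseteq A$) and (2) if $a\in A$ and $b\in M$ with $b\le a$, then $b\in A$. $M$ is left duo if every left ideal of $M$ is two-sided, i.e.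 also a right ideal. A subsemigroup of $M$ is a nonempty subset $A\subseteq M$ with $a\gamma b\in A$ for all $a,b\in A$, $\gamma\in\Gamma$. A filter of $M$ is a subsemigroup $F$ of $M$ such that (1) whenever $a,b\in M$, $\gamma\in\Gamma$ and $a\gamma b\in F$, then $a\in F$ and $b\in F$; and (2) if $a\in F$ and $b\in M$ with $b\ge a$, then $b\in F$. For $x\in M$, $N(x)$ denotes the filter of $M$ generated by $x$, i.e. the least (with respect to inclusion) filter of $M$ containing $x$. *)

theory Defs
  imports Main
begin

text \<open>
  The carrier \<open>M\<close> and the set \<open>\<Gamma>\<close> are explicit sets, the operation is a curried function
  \<open>f a \<gamma> b\<close> standing for \<open>a\<gamma>b\<close>, and \<open>le\<close> is the order; \<open>f\<close> and \<open>le\<close> are constrained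
  only on \<open>M\<close> and \<open>\<Gamma>\<close>.
\<close>

locale gamma_semigroup =
  fixes M :: "'a set" and \<Gamma> :: "'g set" and f :: "'a \<Rightarrow> 'g \<Rightarrow> 'a \<Rightarrow> 'a"
  assumes M_nonempty: "M \<noteq> {}"
    and Gamma_nonempty: "\<Gamma> \<noteq> {}"
    and closed: "\<lbrakk>a \<in> M; \<gamma> \<in> \<Gamma>; b \<in> M\<rbrakk> \<Longrightarrow> f a \<gamma> b \<in> M"
    and assoc: "\<lbrakk>a \<in> M; b \<in> M; c \<in> M; \<gamma> \<in> \<Gamma>; \<mu> \<in> \<Gamma>\<rbrakk> \<Longrightarrow> f a \<gamma> (f b \<mu> c) = f (f a \<gamma> b) \<mu> c"

locale po_gamma_semigroup = gamma_semigroup M \<Gamma> f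
  for M :: "'a set" and \<Gamma> :: "'g set" and f :: "'a \<Rightarrow> 'g \<Rightarrow> 'a \<Rightarrow> 'a" +
  fixes le :: "'a \<Rightarrow> 'a \<Rightarrow> bool"
  assumes le_refl: "reflp_on M le"
    and le_antisym: "antisymp_on M le"
    and le_trans: "transp_on M le"
    and mult_right_mono: "\<lbrakk>a \<in> M; b \<in> M; c \<in> M; \<gamma> \<in> \<Gamma>; le a b\<rbrakk> \<Longrightarrow> le (f a \<gamma> c) (f b \<gamma> c)"
    and mult_left_mono: "\<lbrakk>a \<in> M; b \<in> M; c \<in> M; \<gamma> \<in> \<Gamma>; le a b\<rbrakk> \<Longrightarrow> le (f c \<gamma> a) (f c \<gamma> b)"

definition set_mult :: "'g set \<Rightarrow> ('a \<Rightarrow> 'g \<Rightarrow> 'a \<Rightarrow> 'a) \<Rightarrow> 'a set \<Rightarrow> 'a set \<Rightarrow> 'a set" where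
  "set_mult \<Gamma> f A B = {f a \<gamma> b | a \<gamma> b. a \<in> A \<and> \<gamma> \<in> \<Gamma> \<and> b \<in> B}"

definition down_closure :: "'a set \<Rightarrow> ('a \<Rightarrow> 'a \<Rightarrow> bool) \<Rightarrow> 'a set \<Rightarrow> 'a set" where
  "down_closure M le H = {t \<in> M. \<exists>h\<in>H. le t h}"

definition left_regular ::
    "'a set \<Rightarrow> 'g set \<Rightarrow> ('a \<Rightarrow> 'g \<Rightarrow> 'a \<Rightarrow> 'a) \<Rightarrow> ('a \<Rightarrow> 'a \<Rightarrow> bool) \<Rightarrow> bool" where
  "left_regular M \<Gamma> f le \<longleftrightarrow>
    (\<forall>x\<in>M. \<forall>\<gamma>\<in>\<Gamma>. x \<in> down_closure M le (set_mult \<Gamma> f M {f x \<gamma> x}))"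

definition left_ideal ::
    "'a set \<Rightarrow> 'g set \<Rightarrow> ('a \<Rightarrow> 'g \<Rightarrow> 'a \<Rightarrow> 'a) \<Rightarrow> ('a \<Rightarrow> 'a \<Rightarrow> bool) \<Rightarrow> 'a set \<Rightarrow> bool" where
  "left_ideal M \<Gamma> f le A \<longleftrightarrow> A \<noteq> {} \<and> A \<subseteq> M \<and> set_mult \<Gamma> f M A \<subseteq> A \<and>
    (\<forall>a\<in>A. \<forall>b\<in>M. le b a \<longrightarrow> b \<in> A)"

definition right_ideal ::
    "'a set \<Rightarrow> 'g set \<Rightarrow> ('a \<Rightarrow> 'g \<Rightarrow> 'a \<Rightarrow> 'a) \<Rightarrow> ('a \<Rightarrow> 'a \<Rightarrow> bool) \<Rightarrow> 'a set \<Rightarrow> bool" where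
  "right_ideal M \<Gamma> f le A \<longleftrightarrow> A \<noteq> {} \<and> A \<subseteq> M \<and> set_mult \<Gamma> f A M \<subseteq> A \<and>
    (\<forall>a\<in>A. \<forall>b\<in>M. le b a \<longrightarrow> b \<in> A)"

definition left_duo ::
    "'a set \<Rightarrow> 'g set \<Rightarrow> ('a \<Rightarrow> 'g \<Rightarrow> 'a \<Rightarrow> 'a) \<Rightarrow> ('a \<Rightarrow> 'a \<Rightarrow> bool) \<Rightarrow> bool" where
  "left_duo M \<Gamma> f le \<longleftrightarrow> (\<forall>A. left_ideal M \<Gamma> f le A \<longrightarrow> right_ideal M \<Gamma> f le A)"

definition subsemigroup ::
    "'a set \<Rightarrow> 'g set \<Rightarrow> ('a \<Rightarrow> 'g \<Rightarrow> 'a \<Rightarrow> 'a) \<Rightarrow> 'a set \<Rightarrow> bool" where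
  "subsemigroup M \<Gamma> f A \<longleftrightarrow> A \<noteq> {} \<and> A \<subseteq> M \<and> (\<forall>a\<in>A. \<forall>b\<in>A. \<forall>\<gamma>\<in>\<Gamma>. f a \<gamma> b \<in> A)"

definition gamma_filter ::
    "'a set \<Rightarrow> 'g set \<Rightarrow> ('a \<Rightarrow> 'g \<Rightarrow> 'a \<Rightarrow> 'a) \<Rightarrow> ('a \<Rightarrow> 'a \<Rightarrow> bool) \<Rightarrow> 'a set \<Rightarrow> bool" where
  "gamma_filter M \<Gamma> f le F \<longleftrightarrow> subsemigroup M \<Gamma> f F \<and>
    (\<forall>a\<in>M. \<forall>b\<in>M. \<forall>\<gamma>\<in>\<Gamma>. f a \<gamma> b \<in> F \<longrightarrow> a \<in> F \<and> b \<in> F) \<and>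
    (\<forall>a\<in>F. \<forall>b\<in>M. le a b \<longrightarrow> b \<in> F)"

text \<open>
  The filter \<open>N(x)\<close>. \<open>LEAST\<close> refers to the inclusion order on sets; that the least element
  exists is shown below.
\<close>

definition filter_generated ::
    "'a set \<Rightarrow> 'g set \<Rightarrow> ('a \<Rightarrow> 'g \<Rightarrow> 'a \<Rightarrow> 'a) \<Rightarrow> ('a \<Rightarrow> 'a \<Rightarrow> bool) \<Rightarrow> 'a \<Rightarrow> 'a set" where
  "filter_generated M \<Gamma> f le x = (LEAST F. gamma_filter M \<Gamma> f le F \<and> x \<in> F)"

context po_gamma_semigroup
begin

lemma gamma_filter_Inter:
  assumes "x \<in> M"
  shows "gamma_filter M \<Gamma> f le (\<Inter>{F. gamma_filter M \<Gamma> f le F \<and> x \<in> F})"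
proof -
  define I where "I = \<Inter>{F. gamma_filter M \<Gamma> f le F \<and> x \<in> F}"
  have I_intro: "y \<in> I" if "\<And>F. gamma_filter M \<Gamma> f le F \<Longrightarrow> x \<in> F \<Longrightarrow> y \<in> F" for y
    using that by (simp add: I_def)
  have I_dest: "y \<in> F" if "y \<in> I" "gamma_filter M \<Gamma> f le F" "x \<in> F" for y F
    using that by (simp add: I_def)
  have mult: "f a \<gamma> b \<in> F" if "gamma_filter M \<Gamma> f le F" "a \<in> F" "b \<in> F" "\<gamma> \<in> \<Gamma>" for F a b \<gamma>
  proof -
    from that(1) have "\<forall>a\<in>F. \<forall>b\<in>F. \<forall>\<gamma>\<in>\<Gamma>. f a \<gamma> b \<in> F"
      unfolding gamma_filter_def subsemigroup_def by (elim conjE)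
    from this [rule_format, OF that(2-4)] show ?thesis .
  qed
  have factors: "a \<in> F \<and> b \<in> F"
    if "gamma_filter M \<Gamma> f le F" "f a \<gamma> b \<in> F" "a \<in> M" "b \<in> M" "\<gamma> \<in> \<Gamma>" for F a b \<gamma>
  proof -
    from that(1) have "\<forall>a\<in>M. \<forall>b\<in>M. \<forall>\<gamma>\<in>\<Gamma>. f a \<gamma> b \<in> F \<longrightarrow> a \<in> F \<and> b \<in> F"
      unfolding gamma_filter_def by (elim conjE)
    from this [rule_format, OF that(3-5) that(2)] show ?thesis .
  qed
  have up: "b \<in> F" if "gamma_filter M \<Gamma> f le F" "a \<in> F" "b \<in> M" "le a b" for F a b
  proof -
    from that(1) have "\<forall>a\<in>F. \<forall>b\<in>M. le a b \<longrightarrow> b \<in> F"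
      unfolding gamma_filter_def by (elim conjE)
    from this [rule_format, OF that(2-4)] show ?thesis .
  qed
  have M: "gamma_filter M \<Gamma> f le M"
    unfolding gamma_filter_def subsemigroup_def
    by (intro conjI ballI impI) (simp_all add: M_nonempty closed)
  have "gamma_filter M \<Gamma> f le I"
    unfolding gamma_filter_def subsemigroup_def
  proof (intro conjI ballI impI)
    have "x \<in> I" by (rule I_intro)
    then show "I \<noteq> {}" by auto
    show "I \<subseteq> M" using M assms by (intro subsetI) (rule I_dest)
  next
    fix a b \<gamma> assume ab: "a \<in> I" "b \<in> I" and g: "\<gamma> \<in> \<Gamma>"
    show "f a \<gamma> b \<in> I"
    proof (rule I_intro)
      fix F assume F: "gamma_filter M \<Gamma> f le F" "x \<in> F"
      show "f a \<gamma> b \<in> F" by (rule mult [OF F(1) I_dest [OF ab(1) F] I_dest [OF ab(2) F] g])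
    qed
  next
    fix a b \<gamma> assume ab: "a \<in> M" "b \<in> M" "\<gamma> \<in> \<Gamma>" and prod: "f a \<gamma> b \<in> I"
    have "a \<in> F \<and> b \<in> F" if F: "gamma_filter M \<Gamma> f le F" "x \<in> F" for F
      by (rule factors [OF F(1) I_dest [OF prod F] ab])
    then show "a \<in> I" and "b \<in> I" by (simp_all add: I_intro)
  next
    fix a b assume a: "a \<in> I" and b: "b \<in> M" "le a b"
    show "b \<in> I"
    proof (rule I_intro)
      fix F assume F: "gamma_filter M \<Gamma> f le F" "x \<in> F"
      show "b \<in> F" by (rule up [OF F(1) I_dest [OF a F] b])
    qed
  qed
  then show ?thesis by (simp only: I_def)
qed

lemma filter_generated_eq_Inter:
  assumes "x \<in> M"
  shows "filter_generated M \<Gamma> f le x = \<Inter>{F. gamma_filter M \<Gamma> f le F \<and> x \<in> F}"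
  unfolding filter_generated_def
proof (rule Least_equality)
  show "gamma_filter M \<Gamma> f le (\<Inter>{F. gamma_filter M \<Gamma> f le F \<and> x \<in> F}) \<and>
      x \<in> \<Inter>{F. gamma_filter M \<Gamma> f le F \<and> x \<in> F}"
    using gamma_filter_Inter [OF assms] by simp
next
  fix F assume "gamma_filter M \<Gamma> f le F \<and> x \<in> F"
  then show "\<Inter>{F. gamma_filter M \<Gamma> f le F \<and> x \<in> F} \<subseteq> F"
    by (intro Inter_lower) simp
qed

lemma
  assumes "x \<in> M"
  shows gamma_filter_filter_generated: "gamma_filter M \<Gamma> f le (filter_generated M \<Gamma> f le x)"
    and mem_filter_generated: "x \<in> filter_generated M \<Gamma> f le x"
    and filter_generated_least:
      "\<lbrakk>gamma_filter M \<Gamma> f le F; x \<in> F\<rbrakk> \<Longrightarrow> filter_generated M \<Gamma> f le x \<subseteq> F"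
proof -
  show "gamma_filter M \<Gamma> f le (filter_generated M \<Gamma> f le x)"
    unfolding filter_generated_eq_Inter [OF assms] by (rule gamma_filter_Inter [OF assms])
  show "x \<in> filter_generated M \<Gamma> f le x"
    unfolding filter_generated_eq_Inter [OF assms] by simp
  show "filter_generated M \<Gamma> f le x \<subseteq> F" if "gamma_filter M \<Gamma> f le F" "x \<in> F"
    unfolding filter_generated_eq_Inter [OF assms] using that by (intro Inter_lower) simp
qed

end

end

theory Submission
  imports Defs
begin

text \<open>
  Put \<open>L(y) = (M\<Gamma>y]\<close>, so that the right-hand side is \<open>{y. x \<in> L(y)}\<close>.
  If \<open>M\<close> is left regular and left duo, each \<open>L(y)\<close> is a two-sided ideal containing \<open>y\<close> that is
  semiprime: \<open>x\<gamma>x \<in> L(y)\<close> for some \<open>\<gamma>\<close> implies \<open>x \<in> L(y)\<close>. The delicate point is that \<open>{y. x \<in> L(y)}\<close> is closed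
  under every product \<open>a\<gamma>b\<close>. A semiprime ideal containing \<open>a\<gamma>b\<close> contains \<open>b\<gamma>a\<close>, because
  \<open>(b\<gamma>a)\<gamma>(b\<gamma>a)\<close> has the factor \<open>a\<gamma>b\<close>; hence it contains each \<open>(a\<rho>s)\<sigma>b\<close>, whose
  \<open>\<gamma>\<close>-square has the factor \<open>b\<gamma>a\<close>. From \<open>x \<le> u\<mu>a\<close> and \<open>x \<le> v\<nu>b\<close> we get
  \<open>x\<gamma>x \<le> u\<mu>((a\<gamma>v)\<nu>b)\<close>, so \<open>x\<gamma>x\<close>, and then \<open>x\<close>, lies in \<open>L(a\<gamma>b)\<close>.
  Conversely, \<open>x\<gamma>x \<in> N(x)\<close> yields left regularity, and \<open>a \<in> N(a\<gamma>m)\<close> puts \<open>a\<gamma>m\<close> in \<open>L(a)\<close>,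
  hence in every left ideal containing \<open>a\<close>.
\<close>

lemma left_idealD:
  assumes "left_ideal M \<Gamma> f le A"
  shows left_ideal_subset: "A \<subseteq> M"
    and left_ideal_mult: "\<lbrakk>m \<in> M; \<gamma> \<in> \<Gamma>; a \<in> A\<rbrakk> \<Longrightarrow> f m \<gamma> a \<in> A"
    and left_ideal_down: "\<lbrakk>a \<in> A; b \<in> M; le b a\<rbrakk> \<Longrightarrow> b \<in> A"
  using assms unfolding left_ideal_def set_mult_def by blast+

lemma right_ideal_mult:
  assumes "right_ideal M \<Gamma> f le A" "a \<in> A" "\<gamma> \<in> \<Gamma>" "m \<in> M"
  shows "f a \<gamma> m \<in> A"
  using assms unfolding right_ideal_def set_mult_def by blast

lemma gamma_filterD:
  assumes "gamma_filter M \<Gamma> f le F"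
  shows gamma_filter_mult: "\<lbrakk>a \<in> F; b \<in> F; \<gamma> \<in> \<Gamma>\<rbrakk> \<Longrightarrow> f a \<gamma> b \<in> F"
    and gamma_filter_left: "\<lbrakk>f a \<gamma> b \<in> F; a \<in> M; b \<in> M; \<gamma> \<in> \<Gamma>\<rbrakk> \<Longrightarrow> a \<in> F"
    and gamma_filter_right: "\<lbrakk>f a \<gamma> b \<in> F; a \<in> M; b \<in> M; \<gamma> \<in> \<Gamma>\<rbrakk> \<Longrightarrow> b \<in> F"
    and gamma_filter_up: "\<lbrakk>a \<in> F; b \<in> M; le a b\<rbrakk> \<Longrightarrow> b \<in> F"
  using assms unfolding gamma_filter_def subsemigroup_def by blast+

context po_gamma_semigroup
begin

abbreviation left_multiples :: "'a \<Rightarrow> 'a set" where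
  "left_multiples y \<equiv> down_closure M le (set_mult \<Gamma> f M {y})"

lemma mem_left_multiples:
  "x \<in> left_multiples y \<longleftrightarrow> x \<in> M \<and> (\<exists>u\<in>M. \<exists>\<mu>\<in>\<Gamma>. le x (f u \<mu> y))"
  unfolding down_closure_def set_mult_def by blast

lemma le_transD: "\<lbrakk>le a b; le b c; a \<in> M; b \<in> M; c \<in> M\<rbrakk> \<Longrightarrow> le a c"
  using le_trans by (blast dest: transp_onD)

lemma left_ideal_left_multiples:
  assumes y: "y \<in> M"
  shows "left_ideal M \<Gamma> f le (left_multiples y)"
  unfolding left_ideal_def
proof (intro conjI ballI impI subsetI)
  obtain \<gamma> where "\<gamma> \<in> \<Gamma>" using Gamma_nonempty by blast
  \<comment> \<open>The witness is \<open>f y \<gamma> y\<close>, since \<open>y\<close> itself may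
    fail to lie in \<open>left_multiples y\<close> before left regularity is assumed.\<close>
  then have "f y \<gamma> y \<in> left_multiples y"
    using y closed reflp_onD [OF le_refl] unfolding mem_left_multiples by blast
  then show "left_multiples y \<noteq> {}" by blast
next
  fix x assume "x \<in> set_mult \<Gamma> f M (left_multiples y)"
  then obtain m \<gamma> a where x: "x = f m \<gamma> a" "m \<in> M" "\<gamma> \<in> \<Gamma>" "a \<in> left_multiples y"
    unfolding set_mult_def by blast
  then obtain u \<mu> where u: "a \<in> M" "u \<in> M" "\<mu> \<in> \<Gamma>" "le a (f u \<mu> y)"
    unfolding mem_left_multiples by blast
  have "le x (f (f m \<gamma> u) \<mu> y)"
    using mult_left_mono [of a "f u \<mu> y" m \<gamma>] assoc [of m u y \<gamma> \<mu>] x u y closed by simp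
  then show "x \<in> left_multiples y"
    using x u closed unfolding mem_left_multiples by blast
next
  fix a b assume "a \<in> left_multiples y" "b \<in> M" "le b a"
  then show "b \<in> left_multiples y"
    using y closed le_transD unfolding mem_left_multiples by meson
qed (simp add: mem_left_multiples)

text \<open>\<open>A\<close> absorbs the left factor in \<open>f u \<mu> a\<close> and is closed
  downwards. For \<open>A = left_multiples b\<close> this makes the relation
  \<open>a \<in> left_multiples b\<close> transitive.\<close>

lemma left_multiples_subset:
  assumes A: "left_ideal M \<Gamma> f le A" and a: "a \<in> A"
  shows "left_multiples a \<subseteq> A"
  using left_ideal_mult [OF A _ _ a] left_ideal_down [OF A]
  unfolding mem_left_multiples subset_iff by blast

text \<open>In \<open>f u \<mu> (f y \<gamma> y)\<close> one of the two factors \<open>y\<close> can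
  be moved into the left multiplier.\<close>

lemma left_regular_self_mem:
  assumes "left_regular M \<Gamma> f le" and y: "y \<in> M"
  shows "y \<in> left_multiples y"
proof -
  obtain \<gamma> where g: "\<gamma> \<in> \<Gamma>" using Gamma_nonempty by blast
  then obtain u \<mu> where u: "u \<in> M" "\<mu> \<in> \<Gamma>" "le y (f u \<mu> (f y \<gamma> y))"
    using assms unfolding left_regular_def mem_left_multiples by blast
  then have "le y (f (f u \<mu> y) \<gamma> y)" using assoc y g by simp
  then show ?thesis using y g u closed unfolding mem_left_multiples by blast
qed

text \<open>Left regularity gives \<open>x \<in> left_multiples (f x \<gamma> x)\<close>, and
  \<open>A\<close> contains this set once it contains \<open>f x \<gamma> x\<close>.\<close>

lemma left_regular_semiprime:
  assumes "left_regular M \<Gamma> f le" and A: "left_ideal M \<Gamma> f le A"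
    and "x \<in> M" "\<gamma> \<in> \<Gamma>" "f x \<gamma> x \<in> A"
  shows "x \<in> A"
  using assms left_multiples_subset [OF A] unfolding left_regular_def by blast

context
  fixes A
  assumes regular: "left_regular M \<Gamma> f le"
    and left: "left_ideal M \<Gamma> f le A" and right: "right_ideal M \<Gamma> f le A"
begin

lemma ideal_swap:
  assumes ab: "a \<in> M" "b \<in> M" and g: "\<gamma> \<in> \<Gamma>" and mem: "f a \<gamma> b \<in> A"
  shows "f b \<gamma> a \<in> A"
proof (rule left_regular_semiprime [OF regular left _ g])
  \<comment> \<open>Regrouping exposes \<open>f a \<gamma> b\<close> in the middle, so absorption on
    both sides applies.\<close>
  have "f (f b \<gamma> a) \<gamma> (f b \<gamma> a) = f b \<gamma> (f (f a \<gamma> b) \<gamma> a)"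
    using ab g closed assoc by simp
  then show "f (f b \<gamma> a) \<gamma> (f b \<gamma> a) \<in> A"
    using ab g mem by (simp add: left_ideal_mult [OF left] right_ideal_mult [OF right])
qed (use ab g closed in blast)

lemma ideal_insert:
  assumes M: "a \<in> M" "b \<in> M" "s \<in> M" and G: "\<gamma> \<in> \<Gamma>" "\<rho> \<in> \<Gamma>" "\<sigma> \<in> \<Gamma>"
    and mem: "f a \<gamma> b \<in> A"
  shows "f (f a \<rho> s) \<sigma> b \<in> A"
proof (rule left_regular_semiprime [OF regular left _ G(1)])
  have "f (f (f a \<rho> s) \<sigma> b) \<gamma> (f (f a \<rho> s) \<sigma> b) = f (f a \<rho> s) \<sigma> (f (f b \<gamma> a) \<rho> (f s \<sigma> b))"
    using M G closed assoc by simp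
  moreover have "f (f b \<gamma> a) \<rho> (f s \<sigma> b) \<in> A"
    using right_ideal_mult [OF right ideal_swap [OF M(1,2) G(1) mem]] M G closed by simp
  ultimately show "f (f (f a \<rho> s) \<sigma> b) \<gamma> (f (f a \<rho> s) \<sigma> b) \<in> A"
    using M G closed by (simp add: left_ideal_mult [OF left])
qed (use M G closed in blast)

lemma ideal_prod_left_multiples:
  assumes M: "a \<in> M" "b \<in> M" and g: "\<gamma> \<in> \<Gamma>" and mem: "f a \<gamma> b \<in> A"
    and xa: "x \<in> left_multiples a" and xb: "x \<in> left_multiples b"
  shows "x \<in> A"
proof -
  obtain u \<mu> where u: "x \<in> M" "u \<in> M" "\<mu> \<in> \<Gamma>" "le x (f u \<mu> a)"
    using xa unfolding mem_left_multiples by blast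
  obtain v \<nu> where v: "v \<in> M" "\<nu> \<in> \<Gamma>" "le x (f v \<nu> b)"
    using xb unfolding mem_left_multiples by blast
  have "le (f x \<gamma> x) (f (f u \<mu> a) \<gamma> x)"
    using u M g closed by (intro mult_right_mono) auto
  moreover have "le (f (f u \<mu> a) \<gamma> x) (f (f u \<mu> a) \<gamma> (f v \<nu> b))"
    using u v M g closed by (intro mult_left_mono) auto
  ultimately have "le (f x \<gamma> x) (f (f u \<mu> a) \<gamma> (f v \<nu> b))"
    by (rule le_transD) (use u v M g closed in simp_all)
  moreover have "f (f u \<mu> a) \<gamma> (f v \<nu> b) = f u \<mu> (f (f a \<gamma> v) \<nu> b)"
    using u v M g closed assoc by simp
  \<comment> \<open>The multiplier \<open>v\<close> of \<open>b\<close> is the element inserted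
    between \<open>a\<close> and \<open>b\<close>, with \<open>\<rho> = \<gamma>\<close> and
    \<open>\<sigma> = \<nu>\<close>.\<close>
  moreover have "f u \<mu> (f (f a \<gamma> v) \<nu> b) \<in> A"
    by (rule left_ideal_mult [OF left u(2,3) ideal_insert [OF M v(1) g g v(2) mem]])
  ultimately have "f x \<gamma> x \<in> A"
    using u g closed by (metis left_ideal_down [OF left])
  then show ?thesis by (rule left_regular_semiprime [OF regular left u(1) g])
qed

end

lemma gamma_filter_left_divisors:
  assumes reg: "left_regular M \<Gamma> f le" and duo: "left_duo M \<Gamma> f le" and x: "x \<in> M"
  shows "gamma_filter M \<Gamma> f le {y \<in> M. x \<in> left_multiples y}" (is "gamma_filter _ _ _ _ ?F")
  unfolding gamma_filter_def subsemigroup_def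
proof (intro conjI ballI impI)
  have right: "right_ideal M \<Gamma> f le (left_multiples y)" if "y \<in> M" for y
    using duo left_ideal_left_multiples [OF that] unfolding left_duo_def by blast
  show "?F \<noteq> {}" using left_regular_self_mem [OF reg x] x by blast
  show "?F \<subseteq> M" by blast
  show "f a \<gamma> b \<in> ?F" if "a \<in> ?F" "b \<in> ?F" and g: "\<gamma> \<in> \<Gamma>" for a b \<gamma>
  proof -
    have ab: "a \<in> M" "b \<in> M" "x \<in> left_multiples a" "x \<in> left_multiples b" using that by auto
    then have c: "f a \<gamma> b \<in> M" using g closed by blast
    \<comment> \<open>The two-sided ideal \<open>A\<close> is taken to be
      \<open>left_multiples (f a \<gamma> b)\<close>, which contains \<open>f a \<gamma> b\<close>
      by left regularity.\<close>
    have "x \<in> left_multiples (f a \<gamma> b)"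
      using ideal_prod_left_multiples [OF reg left_ideal_left_multiples [OF c] right [OF c]
          ab(1,2) g left_regular_self_mem [OF reg c] ab(3,4)] .
    then show ?thesis using c by blast
  qed
  fix a b \<gamma> assume ab: "a \<in> M" "b \<in> M" and g: "\<gamma> \<in> \<Gamma>" and "f a \<gamma> b \<in> ?F"
  then have xab: "x \<in> left_multiples (f a \<gamma> b)" by blast
  \<comment> \<open>Here left duo enters: \<open>a\<close> lies in \<open>left_multiples a\<close>,
    which absorbs \<open>b\<close> on the right. Hence
    \<open>left_multiples (f a \<gamma> b)\<close>, and with it \<open>x\<close>, lies in
    \<open>left_multiples a\<close>.\<close>
  have "f a \<gamma> b \<in> left_multiples a"
    using right_ideal_mult [OF right left_regular_self_mem [OF reg]] ab g by blast
  then show "a \<in> ?F"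
    using left_multiples_subset [OF left_ideal_left_multiples] ab xab by blast
  have "f a \<gamma> b \<in> left_multiples b"
    using left_ideal_mult [OF left_ideal_left_multiples _ _ left_regular_self_mem [OF reg]] ab g
    by blast
  then show "b \<in> ?F"
    using left_multiples_subset [OF left_ideal_left_multiples] ab xab by blast
next
  fix a b assume "a \<in> ?F" and b: "b \<in> M" "le a b"
  then obtain u \<mu> where u: "a \<in> M" "u \<in> M" "\<mu> \<in> \<Gamma>" "le x (f u \<mu> a)"
    unfolding mem_left_multiples by blast
  have "le (f u \<mu> a) (f u \<mu> b)" using u b by (intro mult_left_mono)
  then have "le x (f u \<mu> b)" using u x b closed le_transD by meson
  then show "b \<in> ?F" using u x b unfolding mem_left_multiples by blast
qed

text \<open>From \<open>x\<close> the filter passes up to \<open>f u \<mu> y\<close> and then down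
  to the factor \<open>y\<close>. This gives the minimality half of the description of
  \<open>N(x)\<close>.\<close>

lemma left_divisors_subset_filter:
  assumes F: "gamma_filter M \<Gamma> f le F" and x: "x \<in> F"
  shows "{y \<in> M. x \<in> left_multiples y} \<subseteq> F"
proof
  fix y assume "y \<in> {y \<in> M. x \<in> left_multiples y}"
  then obtain u \<mu> where u: "y \<in> M" "u \<in> M" "\<mu> \<in> \<Gamma>" "le x (f u \<mu> y)"
    unfolding mem_left_multiples by blast
  then have "f u \<mu> y \<in> F" using gamma_filter_up [OF F x] closed by blast
  then show "y \<in> F" using gamma_filter_right [OF F] u by blast
qed

lemma filter_generated_eq_left_divisors:
  assumes reg: "left_regular M \<Gamma> f le" and duo: "left_duo M \<Gamma> f le" and x: "x \<in> M"
  shows "filter_generated M \<Gamma> f le x = {y \<in> M. x \<in> left_multiples y}"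
proof
  show "filter_generated M \<Gamma> f le x \<subseteq> {y \<in> M. x \<in> left_multiples y}"
    using filter_generated_least [OF x gamma_filter_left_divisors [OF assms]]
      left_regular_self_mem [OF reg x] x by blast
  show "{y \<in> M. x \<in> left_multiples y} \<subseteq> filter_generated M \<Gamma> f le x"
    using left_divisors_subset_filter gamma_filter_filter_generated [OF x]
      mem_filter_generated [OF x] .
qed

lemma
  assumes eq: "\<forall>x\<in>M. filter_generated M \<Gamma> f le x = {y \<in> M. x \<in> left_multiples y}"
  shows left_regularI_filter_generated: "left_regular M \<Gamma> f le"
    and left_duoI_filter_generated: "left_duo M \<Gamma> f le"
proof -
  show "left_regular M \<Gamma> f le"
    unfolding left_regular_def
  proof (intro ballI)
    fix x \<gamma> assume x: "x \<in> M" and g: "\<gamma> \<in> \<Gamma>"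
    have "f x \<gamma> x \<in> filter_generated M \<Gamma> f le x"
      using gamma_filter_mult [OF gamma_filter_filter_generated] mem_filter_generated x g by blast
    then show "x \<in> left_multiples (f x \<gamma> x)" using eq x by blast
  qed
  show "left_duo M \<Gamma> f le"
    unfolding left_duo_def
  proof (intro allI impI)
    fix A assume A: "left_ideal M \<Gamma> f le A"
    \<comment> \<open>Left and right ideals differ only in the side of absorption, so this is all
      that remains to be shown.\<close>
    have "f a \<gamma> m \<in> A" if a: "a \<in> A" and g: "\<gamma> \<in> \<Gamma>" and m: "m \<in> M" for a \<gamma> m
    proof -
      have aM: "a \<in> M" using left_ideal_subset [OF A] a by blast
      then have c: "f a \<gamma> m \<in> M" using g m closed by blast
      have "a \<in> filter_generated M \<Gamma> f le (f a \<gamma> m)"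
        by (rule gamma_filter_left [OF gamma_filter_filter_generated [OF c]
              mem_filter_generated [OF c] aM m g])
      then have "f a \<gamma> m \<in> left_multiples a" using eq c by blast
      then show ?thesis using left_multiples_subset [OF A a] by blast
    qed
    then show "right_ideal M \<Gamma> f le A"
      using A unfolding left_ideal_def right_ideal_def set_mult_def by blast
  qed
qed

end

theorem theorem6:
  fixes M :: "'a set" and \<Gamma> :: "'g set"
    and f :: "'a \<Rightarrow> 'g \<Rightarrow> 'a \<Rightarrow> 'a" and le :: "'a \<Rightarrow> 'a \<Rightarrow> bool"
  assumes "po_gamma_semigroup M \<Gamma> f le"
  shows "left_regular M \<Gamma> f le \<and> left_duo M \<Gamma> f le \<longleftrightarrow>
    (\<forall>x\<in>M. filter_generated M \<Gamma> f le x =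
      {y \<in> M. x \<in> down_closure M le (set_mult \<Gamma> f M {y})})"
proof -
  interpret po_gamma_semigroup M \<Gamma> f le by (fact assms)
  show ?thesis
    using filter_generated_eq_left_divisors left_regularI_filter_generated
      left_duoI_filter_generated by blast
qed

end
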